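(* For each $\theta,\theta'\in(0,\pi/3)$, one has $h(\theta,\theta')>g(\theta,\theta')$, where $$ \begin{aligned} h(\theta,\theta')=4\Bigg\{&\sin^{-1}\left(\frac{\sin(\theta'/2)}{\cos(\theta/2)}\right)\left(\sin(\theta/2)-\frac13\sin(\theta/2)^3\right)+\sin^{-1}\left(\frac{\sin(\theta/2)}{\cos(\theta'/2)}\right)\left(\sin(\theta'/2)-\frac13\sin(\theta'/2)^3\right)\\ &-\frac23\sin^{-1}\big(\tan(\theta/2)\tan(\theta'/2)\big)-\frac13\sin(\theta'/2)\sin(\theta/2)\sqrt{1-\sin(\theta/2)^2-\sin(\theta'/2)^2}\Bigg\} \end{aligned} $$ and $$ g(\theta,\theta')=4\Bigg\{\sin^{-1}\left(\frac{\sin(\theta/2)}{\cos(\theta'/2)}\right)\sin(\theta'/2)+\sin^{-1}\left(\frac{\sin(\theta'/2)}{\cos(\theta/2)}\right)\sin(\theta/2)-\sin^{-1}\big(\tan(\theta/2)\tan(\theta'/2)\big)\Bigg\}. $$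
   Context: $\sin^{-1}$ denotes the arcsine function, and $\sin(\theta/2)^k$ means $(\sin(\theta/2))^k$. *)

theory Defs
  imports Complex_Main
begin

definition h :: "real \<Rightarrow> real \<Rightarrow> real" where
  "h \<theta> \<theta>' = 4 *
    ( arcsin (sin (\<theta>' / 2) / cos (\<theta> / 2)) * (sin (\<theta> / 2) - 1 / 3 * sin (\<theta> / 2) ^ 3)
    + arcsin (sin (\<theta> / 2) / cos (\<theta>' / 2)) * (sin (\<theta>' / 2) - 1 / 3 * sin (\<theta>' / 2) ^ 3)
    - 2 / 3 * arcsin (tan (\<theta> / 2) * tan (\<theta>' / 2))
    - 1 / 3 * sin (\<theta>' / 2) * sin (\<theta> / 2) * sqrt (1 - sin (\<theta> / 2) ^ 2 - sin (\<theta>' / 2) ^ 2))"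

definition g :: "real \<Rightarrow> real \<Rightarrow> real" where
  "g \<theta> \<theta>' = 4 *
    ( arcsin (sin (\<theta> / 2) / cos (\<theta>' / 2)) * sin (\<theta>' / 2)
    + arcsin (sin (\<theta>' / 2) / cos (\<theta> / 2)) * sin (\<theta> / 2)
    - arcsin (tan (\<theta> / 2) * tan (\<theta>' / 2)))"

end

theory Submission
  imports Defs
begin

text \<open>
  Put \<open>a = sin (\<theta>/2)\<close>, \<open>b = sin (\<theta>'/2)\<close> and \<open>s = sqrt (1 - a\<^sup>2 - b\<^sup>2)\<close>. By
  \<open>arcsin_divide_eq_arctan\<close> the three arcsines are the angles with tangents \<open>b/s\<close>, \<open>a/s\<close> and
  \<open>a b/s\<close>, and the difference of \<open>h\<close> and \<open>g\<close> is \<open>4/3\<close> times the function \<open>gap a b\<close>, which equals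

  \<open>arctan (a b/s) - a\<^sup>3 arctan (b/s) - b\<^sup>3 arctan (a/s) - a b s\<close>.

  In its partial derivative with respect to \<open>a\<close> the algebraic terms collapse and only
  \<open>3 a\<^sup>2 (b/s - arctan (b/s))\<close> remains (\<open>gap_has_derivative\<close>). This is positive because
  \<open>arctan x < x\<close> for \<open>x > 0\<close>. Since \<open>gap 0 b = 0\<close>, the gap is positive on the whole open quarter
  disc \<open>a, b > 0\<close>, \<open>a\<^sup>2 + b\<^sup>2 < 1\<close> (\<open>gap_pos\<close>). Angles below \<open>\<pi>/3\<close> put \<open>a\<close> and \<open>b\<close> below
  \<open>1/2\<close>, hence inside that disc.
\<close>

lemma arctan_less_self:
  fixes x :: real
  assumes "0 < x"
  shows "arctan x < x"
proof -
  have "0 - arctan 0 < x - arctan x"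
  proof (rule DERIV_pos_imp_increasing_open[OF assms, of "\<lambda>t. t - arctan t"])
    fix t :: real assume "0 < t" "t < x"
    then have "inverse (1 + t\<^sup>2) < 1"
      by (simp add: inverse_less_1_iff add_nonneg_nonneg)
    moreover have "((\<lambda>t. t - arctan t) has_real_derivative 1 - inverse (1 + t\<^sup>2)) (at t)"
      by (auto intro!: derivative_eq_intros)
    ultimately show "\<exists>y. ((\<lambda>t. t - arctan t) has_real_derivative y) (at t) \<and> 0 < y"
      by (intro exI[of _ "1 - inverse (1 + t\<^sup>2)"]) simp
  qed (auto intro!: continuous_intros)
  then show ?thesis by simp
qed

text \<open>
  The angle opposite a leg \<open>y\<close> in a right triangle with hypotenuse \<open>c\<close>, read off from its tangent.
\<close>

lemma arcsin_divide_eq_arctan: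
  fixes c y :: real
  assumes "\<bar>y\<bar> < c"
  shows "arcsin (y / c) = arctan (y / sqrt (c\<^sup>2 - y\<^sup>2))"
proof -
  have c: "c > 0" using assms by linarith
  have "- 1 < y / c" "y / c < 1" using assms c by (simp_all add: field_simps)
  then have "arcsin (y / c) = arctan (y / c / sqrt (1 - (y / c)\<^sup>2))"
    by (rule arcsin_arctan)
  also have "1 - (y / c)\<^sup>2 = (c\<^sup>2 - y\<^sup>2) / c\<^sup>2"
    using c by (simp add: field_simps)
  finally show ?thesis using c by (simp add: real_sqrt_divide)
qed

definition gap :: "real \<Rightarrow> real \<Rightarrow> real" where
  "gap a b = (let s = sqrt (1 - a\<^sup>2 - b\<^sup>2) in
     arctan (a * b / s) - a ^ 3 * arctan (b / s) - b ^ 3 * arctan (a / s) - a * b * s)"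

text \<open>
  As \<open>a\<close> varies, \<open>s\<close> has derivative \<open>-a/s\<close>, so the angles with tangents \<open>a b/s\<close>, \<open>b/s\<close>, \<open>a/s\<close>
  have derivatives \<open>b/(s (1 - a\<^sup>2))\<close>, \<open>a b/(s (1 - a\<^sup>2))\<close>, \<open>1/s\<close>. The factor \<open>1 - a\<^sup>2\<close> cancels
  because the first two enter as \<open>(1 - a\<^sup>4) b/(s (1 - a\<^sup>2)) = (1 + a\<^sup>2) b/s\<close>. Adding
  \<open>-b\<^sup>3/s\<close> from the third angle and \<open>-b s + a\<^sup>2 b/s\<close> from the product \<open>a b s\<close> gives
  \<open>3 a\<^sup>2 b/s\<close>; only the derivative of the factor \<open>a\<^sup>3\<close> leaves an arctangent behind.
\<close>

lemma gap_has_derivative: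
  fixes a b :: real
  assumes "a\<^sup>2 + b\<^sup>2 < 1"
  defines "s \<equiv> sqrt (1 - a\<^sup>2 - b\<^sup>2)"
  shows "((\<lambda>t. gap t b) has_real_derivative 3 * a\<^sup>2 * (b / s - arctan (b / s))) (at a)"
proof -
  define r where "r t = sqrt (1 - t\<^sup>2 - b\<^sup>2)" for t
  have s: "s > 0" and s2: "s\<^sup>2 = 1 - a\<^sup>2 - b\<^sup>2" and r: "r a = s"
    using assms by (auto simp: r_def)
  have na: "1 - a\<^sup>2 > 0" and nb: "1 - b\<^sup>2 > 0"
    using assms by (smt (verit) zero_le_power2)+
  have sq: "1 + (y / s)\<^sup>2 = (s\<^sup>2 + y\<^sup>2) / s\<^sup>2" for y
    using s by (simp add: field_simps)
  have dr: "(r has_real_derivative - a / s) (at a)"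
    unfolding r_def using assms s by (auto intro!: derivative_eq_intros simp: field_simps)
  have d1: "((\<lambda>t. arctan (t * b / r t)) has_real_derivative b / (s * (1 - a\<^sup>2))) (at a)"
  proof -
    have "((\<lambda>t. arctan (t * b / r t)) has_real_derivative
        inverse (1 + (a * b / s)\<^sup>2) * ((b * s - a * b * (- a / s)) / (s * s))) (at a)"
      using s by (auto intro!: derivative_eq_intros dr simp: r)
    moreover have "1 + (a * b / s)\<^sup>2 = (1 - a\<^sup>2) * (1 - b\<^sup>2) / s\<^sup>2"
      unfolding sq by (simp add: s2 algebra_simps)
    moreover have "b * s - a * b * (- a / s) = b * (1 - b\<^sup>2) / s"
      using s by (simp add: field_simps s2 flip: power2_eq_square)
    \<comment> \<open>\<open>p\<close> and \<open>q\<close> stand for \<open>1 - a\<^sup>2\<close> and \<open>1 - b\<^sup>2\<close>; as opaque factors they cancel instead of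
      being multiplied out.\<close>
    moreover have "inverse (p * q / s\<^sup>2) * (b * q / s / (s * s)) = b / (s * p)"
      if "p > 0" "q > 0" for p q
      using s that by (simp add: field_simps power2_eq_square)
    ultimately show ?thesis
      using na nb by (simp only:)
  qed
  have d2: "((\<lambda>t. arctan (b / r t)) has_real_derivative a * b / (s * (1 - a\<^sup>2))) (at a)"
  proof -
    have "((\<lambda>t. arctan (b / r t)) has_real_derivative
        inverse (1 + (b / s)\<^sup>2) * (a * b / s / (s * s))) (at a)"
      using s by (auto intro!: derivative_eq_intros dr simp: r)
    moreover have "1 + (b / s)\<^sup>2 = (1 - a\<^sup>2) / s\<^sup>2"
      unfolding sq by (simp add: s2)
    moreover have "inverse (p / s\<^sup>2) * (a * b / s / (s * s)) = a * b / (s * p)" if "p > 0" for p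
      using s that by (simp add: field_simps power2_eq_square)
    ultimately show ?thesis
      using na by (simp only:)
  qed
  have d3: "((\<lambda>t. arctan (t / r t)) has_real_derivative 1 / s) (at a)"
  proof -
    have "((\<lambda>t. arctan (t / r t)) has_real_derivative
        inverse (1 + (a / s)\<^sup>2) * ((s - a * (- a / s)) / (s * s))) (at a)"
      using s by (auto intro!: derivative_eq_intros dr simp: r)
    moreover have "1 + (a / s)\<^sup>2 = (1 - b\<^sup>2) / s\<^sup>2"
      unfolding sq by (simp add: s2)
    moreover have "s - a * (- a / s) = (1 - b\<^sup>2) / s"
      using s by (simp add: field_simps s2 flip: power2_eq_square)
    moreover have "inverse (p / s\<^sup>2) * (p / s / (s * s)) = 1 / s" if "p > 0" for p
      using s that by (simp add: field_simps power2_eq_square)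
    ultimately show ?thesis
      using nb by (simp only:)
  qed
  have "((\<lambda>t. gap t b) has_real_derivative
      b / (s * (1 - a\<^sup>2)) - (3 * a\<^sup>2 * arctan (b / s) + a ^ 3 * (a * b / (s * (1 - a\<^sup>2))))
      - b ^ 3 * (1 / s) - (b * s + a * b * (- a / s))) (at a)"
    unfolding gap_def Let_def r_def[symmetric]
    by (rule DERIV_cong, (rule d1 d2 d3 dr DERIV_diff DERIV_mult DERIV_pow DERIV_ident DERIV_const)+)
      (simp add: r numeral_2_eq_2 algebra_simps)
  moreover have "b / (s * (1 - a\<^sup>2)) - a ^ 3 * (a * b / (s * (1 - a\<^sup>2))) = b * (1 + a\<^sup>2) / s"
  proof -
    have "b / (s * (1 - a\<^sup>2)) - a ^ 3 * (a * b / (s * (1 - a\<^sup>2)))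
        = b * (1 + a\<^sup>2) * (1 - a\<^sup>2) / (s * (1 - a\<^sup>2))"
      by (simp add: diff_divide_distrib[symmetric] algebra_simps eval_nat_numeral)
    then show ?thesis using na by simp
  qed
  moreover have "b * (1 + a\<^sup>2) / s - b ^ 3 * (1 / s) - (b * s + a * b * (- a / s)) = 3 * a\<^sup>2 * (b / s)"
  proof -
    have "b * s = b * (1 - a\<^sup>2 - b\<^sup>2) / s"
      unfolding s2[symmetric] using s by (simp add: power2_eq_square)
    then have "b * (1 + a\<^sup>2) / s - b ^ 3 * (1 / s) - (b * s + a * b * (- a / s))
        = (b * (1 + a\<^sup>2) - b ^ 3 - (b * (1 - a\<^sup>2 - b\<^sup>2) - a * b * a)) / s"
      by (simp add: diff_divide_distrib)
    then show ?thesis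
      by (simp add: algebra_simps eval_nat_numeral)
  qed
  ultimately show ?thesis by (simp add: algebra_simps)
qed

lemma gap_pos:
  fixes a b :: real
  assumes "0 < a" "0 < b" "a\<^sup>2 + b\<^sup>2 < 1"
  shows "0 < gap a b"
proof -
  have disc: "t\<^sup>2 + b\<^sup>2 < 1" if "0 \<le> t" "t \<le> a" for t
    using power_mono[OF that(2,1), of 2] assms by linarith
  have "gap 0 b < gap a b"
  proof (rule DERIV_pos_imp_increasing_open[OF \<open>0 < a\<close>])
    fix t assume t: "0 < t" "t < a"
    let ?q = "b / sqrt (1 - t\<^sup>2 - b\<^sup>2)"
    have "0 < ?q" using disc[of t] t assms by simp
    then have "0 < 3 * t\<^sup>2 * (?q - arctan ?q)"
      using arctan_less_self t by simp
    then show "\<exists>y. ((\<lambda>t. gap t b) has_real_derivative y) (at t) \<and> 0 < y"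
      using gap_has_derivative[of t b] disc[of t] t by auto
  next
    show "continuous_on {0..a} (\<lambda>t. gap t b)"
      by (rule DERIV_continuous_on, rule has_field_derivative_at_within,
          rule gap_has_derivative, rule disc) auto
  qed
  then show ?thesis by (simp add: gap_def)
qed

theorem lemmaA1:
  fixes \<theta> \<theta>' :: real
  assumes "\<theta> \<in> {0<..<pi / 3}" and "\<theta>' \<in> {0<..<pi / 3}"
  shows "h \<theta> \<theta>' > g \<theta> \<theta>'"
proof -
  have half: "0 < sin (x / 2) \<and> sin (x / 2) < 1 / 2 \<and> 1 / 2 < cos (x / 2)"
    if "x \<in> {0<..<pi / 3}" for x :: real
    using that sin_gt_zero[of "x / 2"] sin_monotone_2pi[of "x / 2" "pi / 6"]
      cos_monotone_0_pi[of "x / 2" "pi / 3"]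
    by (auto simp: sin_30 cos_60)
  define a b c d where "a = sin (\<theta> / 2)" and "b = sin (\<theta>' / 2)"
    and "c = cos (\<theta> / 2)" and "d = cos (\<theta>' / 2)"
  define s where "s = sqrt (1 - a\<^sup>2 - b\<^sup>2)"
  have bounds: "0 < a" "a < 1 / 2" "1 / 2 < c" "0 < b" "b < 1 / 2" "1 / 2 < d"
    using half[OF assms(1)] half[OF assms(2)] by (auto simp: a_def b_def c_def d_def)
  have c2: "c\<^sup>2 = 1 - a\<^sup>2" and d2: "d\<^sup>2 = 1 - b\<^sup>2"
    by (simp_all add: a_def b_def c_def d_def cos_squared_eq)
  have "a * b < c * d" using bounds by (intro mult_strict_mono) auto
  then have "arcsin (a * b / (c * d)) = arctan (a * b / sqrt ((c * d)\<^sup>2 - (a * b)\<^sup>2))"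
    using bounds by (intro arcsin_divide_eq_arctan) simp
  also have "(c * d)\<^sup>2 - (a * b)\<^sup>2 = 1 - a\<^sup>2 - b\<^sup>2"
    by (simp add: power_mult_distrib c2 d2 algebra_simps)
  finally have ab: "arcsin (tan (\<theta> / 2) * tan (\<theta>' / 2)) = arctan (a * b / s)"
    by (simp add: s_def tan_def a_def b_def c_def d_def)
  have A: "arcsin (b / c) = arctan (b / s)"
    using arcsin_divide_eq_arctan[of b c] bounds by (simp add: c2 s_def)
  have B: "arcsin (a / d) = arctan (a / s)"
    using arcsin_divide_eq_arctan[of a d] bounds by (simp add: d2 s_def algebra_simps)
  have "h \<theta> \<theta>' - g \<theta> \<theta>' = 4 / 3 * gap a b"
    unfolding h_def g_def gap_def Let_def ab
      a_def[symmetric] b_def[symmetric] c_def[symmetric] d_def[symmetric] A B s_def[symmetric]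
    by (simp add: algebra_simps)
  moreover have "a\<^sup>2 + b\<^sup>2 < 1"
    using power_strict_mono[of a "1 / 2" 2] power_strict_mono[of b "1 / 2" 2] bounds
    by (simp add: power2_eq_square)
  ultimately show ?thesis
    using gap_pos[of a b] bounds by linarith
qed

end
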